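(* Let $n\geq 2$, and let $G_1$ and $G_2$ be two distinct subgraphs of the augmented cube $AQ_n$, each isomorphic to the hypercube $Q_n$, chosen so that $|E(G_1)\cap E(G_2)|$ is minimum among all pairs of distinct $Q_n$-isomorphic subgraphs of $AQ_n$. Then $E(G_1)\cap E(G_2)$ is a perfect matching of $AQ_n$.
   Context: The hypercube $Q_n$ has vertex set $\{0,1\}^n$ (strings $x_n\cdots x_1$), two vertices adjacent iff they differ in exactly one bit. The augmented cube $AQ_n$ has vertex set $\{0,1\}^n$, and $u=u_n\cdots u_1$, $v=v_n\cdots v_1$ are adjacent iff either they differ in exactly one bit position (hypercube edge), or there is $j\in\{2,\dots,n\}$ such that $v_l\neq u_l$ for all $l\leq j$ and $v_l=u_l$ for all $l>j$ (augmented edge of dimension $j$). *)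

theory Defs
  imports Complex_Main "HOL-Library.FuncSet"
begin

record 'v graph =
  verts :: "'v set"
  edges :: "'v set set"

definition simple_graph :: "'v graph \<Rightarrow> bool" where
  "simple_graph G \<longleftrightarrow> finite (verts G) \<and> (\<forall>e\<in>edges G. e \<subseteq> verts G \<and> card e = 2)"

definition subgraph :: "'v graph \<Rightarrow> 'v graph \<Rightarrow> bool" where
  "subgraph H G \<longleftrightarrow> simple_graph H \<and> verts H \<subseteq> verts G \<and> edges H \<subseteq> edges G"

definition isomorphic :: "'v graph \<Rightarrow> 'w graph \<Rightarrow> bool" where
  "isomorphic G H \<longleftrightarrow>
     (\<exists>f. bij_betw f (verts G) (verts H) \<and>
          (\<forall>u\<in>verts G. \<forall>v\<in>verts G. {u, v} \<in> edges G \<longleftrightarrow> {f u, f v} \<in> edges H))"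

definition perfect_matching :: "'v graph \<Rightarrow> 'v set set \<Rightarrow> bool" where
  "perfect_matching G M \<longleftrightarrow> M \<subseteq> edges G \<and> (\<forall>v\<in>verts G. \<exists>!e. e \<in> M \<and> v \<in> e)"

text \<open>A bit string \<open>x\<^sub>n \<dots> x\<^sub>1\<close> is the function \<open>i \<mapsto> x\<^sub>i\<close> on \<open>{1..n}\<close>, extended by
  \<^const>\<open>undefined\<close> elsewhere, so that distinct functions are distinct strings.\<close>

definition bit_strings :: "nat \<Rightarrow> (nat \<Rightarrow> bool) set" where
  "bit_strings n = {1..n} \<rightarrow>\<^sub>E UNIV"

definition hypercube_adj :: "nat \<Rightarrow> (nat \<Rightarrow> bool) \<Rightarrow> (nat \<Rightarrow> bool) \<Rightarrow> bool" where
  "hypercube_adj n u v \<longleftrightarrow> (\<exists>!i. i \<in> {1..n} \<and> u i \<noteq> v i)"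

definition augmented_adj :: "nat \<Rightarrow> nat \<Rightarrow> (nat \<Rightarrow> bool) \<Rightarrow> (nat \<Rightarrow> bool) \<Rightarrow> bool" where
  "augmented_adj n j u v \<longleftrightarrow> (\<forall>l\<in>{1..j}. v l \<noteq> u l) \<and> (\<forall>l\<in>{j<..n}. v l = u l)"

definition hypercube :: "nat \<Rightarrow> (nat \<Rightarrow> bool) graph" where
  "hypercube n =
     \<lparr>verts = bit_strings n,
      edges = {{u, v} | u v. u \<in> bit_strings n \<and> v \<in> bit_strings n \<and> hypercube_adj n u v}\<rparr>"

definition augmented_cube :: "nat \<Rightarrow> (nat \<Rightarrow> bool) graph" where
  "augmented_cube n =
     \<lparr>verts = bit_strings n,
      edges = {{u, v} | u v. u \<in> bit_strings n \<and> v \<in> bit_strings n \<and>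
                 (hypercube_adj n u v \<or> (\<exists>j\<in>{2..n}. augmented_adj n j u v))}\<rparr>"

definition cube_subgraph :: "nat \<Rightarrow> (nat \<Rightarrow> bool) graph \<Rightarrow> bool" where
  "cube_subgraph n G \<longleftrightarrow> subgraph G (augmented_cube n) \<and> isomorphic G (hypercube n)"

lemma finite_bit_strings: "finite (bit_strings n)"
  by (simp add: bit_strings_def finite_PiE)

lemma simple_graph_hypercube: "simple_graph (hypercube n)"
  by (auto simp: simple_graph_def hypercube_def hypercube_adj_def finite_bit_strings card_2_iff)

lemma simple_graph_augmented_cube: "simple_graph (augmented_cube n)"
proof -
  have "u \<noteq> v" if "hypercube_adj n u v \<or> (\<exists>j\<in>{2..n}. augmented_adj n j u v)" for u v
    using that by (fastforce simp: hypercube_adj_def augmented_adj_def)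
  then show ?thesis
    by (fastforce simp: simple_graph_def augmented_cube_def finite_bit_strings card_2_iff)
qed

end

theory Submission imports Defs begin

text \<open>Every vertex has degree \<open>n\<close> in each copy of \<open>Q\<^sub>n\<close> but only \<open>2n - 1\<close> in \<open>AQ\<^sub>n\<close>, so two copies
  share an edge at every vertex. The hypercube and the copy spanned by the edges that flip an
  initial segment \<open>{1..j}\<close> of the bits share exactly the edges flipping bit 1, hence exactly one edge
  at every vertex; the latter is a hypercube because replacing each bit by its sum with the next
  higher one turns flipping \<open>{1..j}\<close> into flipping bit \<open>j\<close>. A minimal pair thus shares at most half as many edges as there are vertices,
  which leaves room for only one edge at each vertex.\<close>

section \<open>Degree counting and perfect matchings\<close>

definition nbrs :: "'v set set \<Rightarrow> 'v \<Rightarrow> 'v set" where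
  "nbrs E v = {w. {v, w} \<in> E}"

text \<open>Sending a neighbour \<open>w\<close> to the edge \<open>{v, w}\<close> is a bijection;
  that edges have two elements makes it onto. This lets degrees be computed on vertices, while
  matchings speak of edges.\<close>

lemma card_incident_edges:
  assumes "\<forall>e\<in>E. card e = 2"
  shows "card {e \<in> E. v \<in> e} = card (nbrs E v)"
proof -
  have "{e \<in> E. v \<in> e} = (\<lambda>w. {v, w}) ` nbrs E v"
  proof (intro equalityI subsetI)
    fix e assume e: "e \<in> {e \<in> E. v \<in> e}"
    then obtain x y where "e = {x, y}"
      using assms by (auto simp: card_2_iff)
    with e show "e \<in> (\<lambda>w. {v, w}) ` nbrs E v"
      by (auto simp: nbrs_def image_iff insert_commute)
  qed (auto simp: nbrs_def)
  moreover have "inj_on (\<lambda>w. {v, w}) (nbrs E v)"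
    by (auto simp: inj_on_def doubleton_eq_iff)
  ultimately show ?thesis
    by (simp add: card_image)
qed

text \<open>The handshake lemma: count the pairs of a vertex and an edge containing it, first by
  vertices, then by edges.\<close>

lemma sum_degrees:
  assumes "finite V" and "\<forall>e\<in>E. e \<subseteq> V \<and> card e = 2"
  shows "(\<Sum>v\<in>V. card (nbrs E v)) = 2 * card E"
proof -
  have "E \<subseteq> Pow V" using assms(2) by blast
  then have "finite E" using assms(1) finite_subset by blast
  moreover have "{v \<in> V. v \<in> e} = e" if "e \<in> E" for e
    using that assms(2) by blast
  ultimately have "(\<Sum>v\<in>V. card {e \<in> E. v \<in> e}) = 2 * card E"
    using assms by (intro sum_multicount) auto
  then show ?thesis
    using assms(2) by (simp add: card_incident_edges)
qed

lemma finite_nbrs: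
  assumes "finite V" and "\<forall>e\<in>E. e \<subseteq> V"
  shows "finite (nbrs E v)"
proof (rule finite_subset)
  show "nbrs E v \<subseteq> V" using assms(2) by (auto simp: nbrs_def)
qed (rule assms(1))

text \<open>The degrees in \<open>M\<close> are at least 1 and sum to \<open>2 * card M\<close>,
  which is at most the number of vertices. So the sum is tight and no degree can exceed 1.\<close>

lemma perfect_matchingI:
  assumes "finite (verts G)" and "M \<subseteq> edges G" and M: "\<forall>e\<in>M. e \<subseteq> verts G \<and> card e = 2"
    and pos: "\<And>v. v \<in> verts G \<Longrightarrow> 1 \<le> card (nbrs M v)"
    and le: "2 * card M \<le> card (verts G)"
  shows "perfect_matching G M"
proof -
  have "(\<Sum>v\<in>verts G. card (nbrs M v)) \<le> (\<Sum>v\<in>verts G. 1)"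
    using sum_degrees[OF assms(1) M] le by simp
  moreover have "(\<Sum>v\<in>verts G. 1) \<le> (\<Sum>v\<in>verts G. card (nbrs M v))"
    using pos by (rule sum_mono)
  ultimately have eq: "(\<Sum>v\<in>verts G. 1) = (\<Sum>v\<in>verts G. card (nbrs M v))"
    by (rule order_antisym[rotated])
  have "\<exists>!e. e \<in> M \<and> v \<in> e" if v: "v \<in> verts G" for v
  proof -
    \<comment> \<open>Two sums that agree and are ordered term by term agree in every term.\<close>
    have "1 = card (nbrs M v)"
      using sum_mono_inv[OF eq pos v assms(1)] .
    then have "card {e \<in> M. v \<in> e} = 1"
      using card_incident_edges M by metis
    then obtain e where "{e \<in> M. v \<in> e} = {e}"
      by (auto simp: card_1_singleton_iff)
    then have "e' \<in> M \<and> v \<in> e' \<longleftrightarrow> e' = e" for e'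
      by (simp add: set_eq_iff)
    then show ?thesis by simp
  qed
  then show ?thesis
    using assms(2) by (auto simp: perfect_matching_def)
qed

section \<open>Adjacency and degrees in the hypercube and the augmented cube\<close>

lemma bit_strings_eqI:
  assumes "u \<in> bit_strings n" "v \<in> bit_strings n" "\<And>i. i \<in> {1..n} \<Longrightarrow> u i = v i"
  shows "u = v"
  using assms unfolding bit_strings_def by (rule PiE_ext)

lemma hypercube_adj_sym: "hypercube_adj n u v \<longleftrightarrow> hypercube_adj n v u"
  by (simp only: hypercube_adj_def eq_commute[of "u _" "v _"])

lemma augmented_adj_sym: "augmented_adj n j u v \<longleftrightarrow> augmented_adj n j v u"
  by (simp only: augmented_adj_def eq_commute[of "u _" "v _"])

lemma edges_hypercube_iff:
  "{u, v} \<in> edges (hypercube n) \<longleftrightarrow>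
     u \<in> bit_strings n \<and> v \<in> bit_strings n \<and> hypercube_adj n u v"
  by (auto simp: hypercube_def doubleton_eq_iff hypercube_adj_sym)

lemma edges_augmented_cube_iff:
  "{u, v} \<in> edges (augmented_cube n) \<longleftrightarrow> u \<in> bit_strings n \<and> v \<in> bit_strings n \<and>
     (hypercube_adj n u v \<or> (\<exists>j\<in>{2..n}. augmented_adj n j u v))"
  by (auto simp: augmented_cube_def doubleton_eq_iff hypercube_adj_sym augmented_adj_sym)

lemma verts_hypercube: "verts (hypercube n) = bit_strings n"
  by (simp add: hypercube_def)

lemma verts_augmented_cube: "verts (augmented_cube n) = bit_strings n"
  by (simp add: augmented_cube_def)

text \<open>The neighbours of \<open>w\<close> arise by flipping one of its \<open>n\<close> bits,
  and different positions give different strings.\<close>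

lemma card_nbrs_hypercube:
  assumes "w \<in> bit_strings n"
  shows "card (nbrs (edges (hypercube n)) w) = n"
proof -
  have "nbrs (edges (hypercube n)) w = (\<lambda>i. w(i := \<not> w i)) ` {1..n}"
  proof (intro equalityI subsetI)
    fix v assume "v \<in> nbrs (edges (hypercube n)) w"
    then have v: "v \<in> bit_strings n" "hypercube_adj n w v"
      by (auto simp: nbrs_def edges_hypercube_iff)
    then obtain i where i: "i \<in> {1..n}" "w i \<noteq> v i"
      "\<And>k. k \<in> {1..n} \<Longrightarrow> w k \<noteq> v k \<Longrightarrow> k = i"
      unfolding hypercube_adj_def by blast
    have "v = w(i := \<not> w i)"
    proof (rule bit_strings_eqI[OF v(1)])
      show "w(i := \<not> w i) \<in> bit_strings n"
        using assms i(1) by (auto simp: bit_strings_def PiE_def extensional_def)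
    qed (metis i(2,3) fun_upd_apply)
    with i(1) show "v \<in> (\<lambda>i. w(i := \<not> w i)) ` {1..n}" by blast
  next
    fix v assume "v \<in> (\<lambda>i. w(i := \<not> w i)) ` {1..n}"
    then obtain i where i: "i \<in> {1..n}" and v: "v = w(i := \<not> w i)" by blast
    have "hypercube_adj n w v"
      unfolding hypercube_adj_def
      using i by (intro ex1I[of _ i]) (simp_all add: v split: if_splits)
    moreover have "v \<in> bit_strings n"
      using assms i by (auto simp: v bit_strings_def PiE_def extensional_def)
    ultimately show "v \<in> nbrs (edges (hypercube n)) w"
      using assms by (simp add: nbrs_def edges_hypercube_iff)
  qed
  moreover have "inj_on (\<lambda>i. w(i := \<not> w i)) {1..n}"
    by (rule inj_onI) (metis fun_upd_apply)
  ultimately show ?thesis by (simp add: card_image)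
qed

text \<open>A neighbour is determined by the set of flipped positions: one of \<open>n\<close>
  singletons, or one of the \<open>n - 1\<close> prefixes \<open>{1..j}\<close> with
  \<open>j\<close> at least 2. An upper bound suffices for the pigeonhole argument to come.\<close>

lemma card_nbrs_augmented_cube:
  assumes "u \<in> bit_strings n"
  shows "card (nbrs (edges (augmented_cube n)) u) \<le> n + (n - 1)"
proof -
  \<comment> \<open>On booleans \<open>\<noteq>\<close> is exclusive or, so \<open>flip A\<close> is
    \<open>u\<close> with the bits in \<open>A\<close> negated.\<close>
  define flip where "flip A = (\<lambda>i\<in>{1..n}. u i \<noteq> (i \<in> A))" for A :: "nat set"
  have flipI: "v = flip A"
    if "v \<in> bit_strings n" "\<And>i. i \<in> {1..n} \<Longrightarrow> (u i \<noteq> v i) = (i \<in> A)" for v A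
    using that by (intro bit_strings_eqI[of v n]) (auto simp: flip_def bit_strings_def)
  let ?F = "flip ` ((\<lambda>i. {i}) ` {1..n} \<union> (\<lambda>j. {1..j}) ` {2..n})"
  have "v \<in> ?F" if "v \<in> nbrs (edges (augmented_cube n)) u" for v
  proof -
    from that have v: "v \<in> bit_strings n"
      and "hypercube_adj n u v \<or> (\<exists>j\<in>{2..n}. augmented_adj n j u v)"
      by (auto simp: nbrs_def edges_augmented_cube_iff)
    then consider "hypercube_adj n u v" | j where "j \<in> {2..n}" "augmented_adj n j u v"
      by blast
    then show ?thesis
    proof cases
      case 1
      then obtain i where i: "i \<in> {1..n}" "u i \<noteq> v i"
        "\<And>k. k \<in> {1..n} \<Longrightarrow> u k \<noteq> v k \<Longrightarrow> k = i"
        unfolding hypercube_adj_def by blast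
      have "(u k \<noteq> v k) = (k \<in> {i})" if "k \<in> {1..n}" for k
        using that i by blast
      then have "v = flip {i}" using v by (intro flipI)
      with i(1) show ?thesis by blast
    next
      case 2
      then have "v = flip {1..j}"
        using v by (intro flipI) (auto simp: augmented_adj_def)
      with 2(1) show ?thesis by blast
    qed
  qed
  then have "card (nbrs (edges (augmented_cube n)) u) \<le> card ?F"
    by (intro card_mono) auto
  also have "\<dots> \<le> card ((\<lambda>i. {i}) ` {1..n} \<union> (\<lambda>j. {1..j}) ` {2..n})"
    by (rule card_image_le) simp
  also have "\<dots> \<le> card ((\<lambda>i. {i}) ` {1..n}) + card ((\<lambda>j. {1..j}) ` {2..n})"
    by (rule card_Un_le)
  also have "\<dots> \<le> card {1..n} + card {2..n}"
    by (intro add_mono card_image_le) auto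
  finally show ?thesis by simp
qed

section \<open>Copies of the hypercube inside the augmented cube\<close>

lemma cube_subgraph_verts:
  assumes "cube_subgraph n G"
  shows "verts G = bit_strings n"
proof (rule card_subset_eq)
  show "verts G \<subseteq> bit_strings n"
    using assms by (auto simp: cube_subgraph_def subgraph_def verts_augmented_cube)
  \<comment> \<open>The isomorphism makes \<open>verts G\<close> as large as the finite set
    containing it, which forces a copy to be spanning.\<close>
  show "card (verts G) = card (bit_strings n)"
    using assms by (auto simp: cube_subgraph_def isomorphic_def verts_hypercube
        dest: bij_betw_same_card)
qed (rule finite_bit_strings)

lemma cube_subgraph_edges:
  assumes "cube_subgraph n G" "e \<in> edges G"
  shows "e \<subseteq> bit_strings n" "card e = 2" "e \<in> edges (augmented_cube n)"
  using assms cube_subgraph_verts[OF assms(1)]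
  by (auto simp: cube_subgraph_def subgraph_def simple_graph_def)

text \<open>An isomorphism carries the neighbours of \<open>u\<close> bijectively onto those of its
  image, so regularity of degree \<open>n\<close> passes to every copy.\<close>

lemma card_nbrs_cube_subgraph:
  assumes G: "cube_subgraph n G" and u: "u \<in> bit_strings n"
  shows "card (nbrs (edges G) u) = n"
proof -
  obtain f where f: "bij_betw f (bit_strings n) (bit_strings n)"
    and adj: "\<And>u v. u \<in> bit_strings n \<Longrightarrow> v \<in> bit_strings n \<Longrightarrow>
                {u, v} \<in> edges G \<longleftrightarrow> {f u, f v} \<in> edges (hypercube n)"
    using G cube_subgraph_verts[OF G]
    by (auto simp: cube_subgraph_def isomorphic_def verts_hypercube)
  have nbrs: "nbrs (edges G) u \<subseteq> bit_strings n"
    using cube_subgraph_edges(1)[OF G] by (auto simp: nbrs_def)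
  have "f ` nbrs (edges G) u = nbrs (edges (hypercube n)) (f u)"
  proof (intro equalityI subsetI)
    fix w assume "w \<in> nbrs (edges (hypercube n)) (f u)"
    then have w: "{f u, w} \<in> edges (hypercube n)" by (simp add: nbrs_def)
    then have "w \<in> bit_strings n" by (simp add: edges_hypercube_iff)
    then obtain v where v: "v \<in> bit_strings n" "w = f v"
      using f by (auto simp: bij_betw_def)
    with w show "w \<in> f ` nbrs (edges G) u"
      using adj[OF u v(1)] by (auto simp: nbrs_def)
  next
    fix w assume "w \<in> f ` nbrs (edges G) u"
    then show "w \<in> nbrs (edges (hypercube n)) (f u)"
      using nbrs adj[OF u] by (auto simp: nbrs_def)
  qed
  moreover have "inj_on f (nbrs (edges G) u)"
    using f nbrs by (auto simp: bij_betw_def intro: inj_on_subset)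
  ultimately have "card (nbrs (edges G) u) = card (nbrs (edges (hypercube n)) (f u))"
    by (metis card_image)
  also have "\<dots> = n"
    using f u by (intro card_nbrs_hypercube) (auto simp: bij_betw_def)
  finally show ?thesis .
qed

text \<open>Pigeonhole: two sets of \<open>n\<close> neighbours lie in a set of at most
  \<open>2n - 1\<close>, so they meet.\<close>

lemma cube_subgraphs_common_nbr:
  assumes "1 \<le> n" and G1: "cube_subgraph n G1" and G2: "cube_subgraph n G2"
    and u: "u \<in> bit_strings n"
  shows "1 \<le> card (nbrs (edges G1 \<inter> edges G2) u)"
proof -
  let ?N1 = "nbrs (edges G1) u" and ?N2 = "nbrs (edges G2) u"
  have fin: "finite ?N1" "finite ?N2" "finite (nbrs (edges (augmented_cube n)) u)"
    using cube_subgraph_edges(1)[OF G1] cube_subgraph_edges(1)[OF G2]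
      simple_graph_augmented_cube[of n]
    by (auto simp: simple_graph_def verts_augmented_cube intro!: finite_nbrs[OF finite_bit_strings[of n]])
  have "?N1 \<union> ?N2 \<subseteq> nbrs (edges (augmented_cube n)) u"
    using cube_subgraph_edges(3)[OF G1] cube_subgraph_edges(3)[OF G2] by (auto simp: nbrs_def)
  then have "card (?N1 \<union> ?N2) \<le> n + (n - 1)"
    using card_mono[OF fin(3)] card_nbrs_augmented_cube[OF u] order_trans by blast
  moreover have "card ?N1 + card ?N2 = card (?N1 \<union> ?N2) + card (?N1 \<inter> ?N2)"
    using fin by (intro card_Un_Int)
  ultimately have "1 \<le> card (?N1 \<inter> ?N2)"
    using card_nbrs_cube_subgraph[OF G1 u] card_nbrs_cube_subgraph[OF G2 u] \<open>1 \<le> n\<close> by linarith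
  moreover have "?N1 \<inter> ?N2 = nbrs (edges G1 \<inter> edges G2) u"
    by (auto simp: nbrs_def)
  ultimately show ?thesis by simp
qed

section \<open>The cube of prefix flips\<close>

definition prefix_cube :: "nat \<Rightarrow> (nat \<Rightarrow> bool) graph" where
  "prefix_cube n =
     \<lparr>verts = bit_strings n,
      edges = {{u, v} | u v. u \<in> bit_strings n \<and> v \<in> bit_strings n \<and>
                 (\<exists>j\<in>{1..n}. augmented_adj n j u v)}\<rparr>"

lemma edges_prefix_cube_iff:
  "{u, v} \<in> edges (prefix_cube n) \<longleftrightarrow>
     u \<in> bit_strings n \<and> v \<in> bit_strings n \<and> (\<exists>j\<in>{1..n}. augmented_adj n j u v)"
  by (auto simp: prefix_cube_def doubleton_eq_iff augmented_adj_sym)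

text \<open>Descend from the top: at \<open>n\<close> the hypothesis gives False, and below
  \<open>n\<close> each value copies the one above it.\<close>

lemma zero_above_if_no_change:
  assumes "\<And>l. j < l \<Longrightarrow> l \<le> n \<Longrightarrow> d l = (l < n \<and> d (Suc l))"
    and "j < l" "l \<le> n"
  shows "\<not> d l"
  using assms(2,3)
proof (induction "n - l" arbitrary: l)
  case 0
  then show ?case using assms(1)[of l] by simp
next
  case (Suc k)
  then show ?case using assms(1)[of l] by auto
qed

text \<open>Take \<open>d\<close> as the difference of two strings, continued by False past
  \<open>n\<close>. Reading downwards, \<open>d\<close> starts at False, so exactly one change, at
  \<open>j\<close>, means False above \<open>j\<close> and True from \<open>j\<close> down to
  1.\<close>

lemma unique_change_iff_prefix:
  "(\<exists>!i. i \<in> {1..n} \<and> d i \<noteq> (i < n \<and> d (Suc i))) \<longleftrightarrow>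
   (\<exists>j\<in>{1..n}. (\<forall>l\<in>{1..j}. d l) \<and> (\<forall>l\<in>{j<..n}. \<not> d l))" (is "?L \<longleftrightarrow> ?R")
proof
  assume ?L
  then obtain j where j: "j \<in> {1..n}" "d j \<noteq> (j < n \<and> d (Suc j))"
    and uniq: "\<And>l. l \<in> {1..n} \<Longrightarrow> l \<noteq> j \<Longrightarrow> d l = (l < n \<and> d (Suc l))"
    by blast
  have above: "\<not> d l" if "j < l" "l \<le> n" for l
    by (rule zero_above_if_no_change[OF _ that]) (rule uniq, auto)
  \<comment> \<open>The value following \<open>j\<close> is False, so a change at \<open>j\<close>
    makes \<open>d j\<close> true; with no change below \<open>j\<close>, this value then propagates
    down to 1.\<close>
  then have "d j" using j by auto
  have "d l" if "l \<le> j" "1 \<le> l" for l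
    using that
  proof (induction rule: inc_induct)
    case (step l)
    then show ?case using uniq[of l] j(1) by auto
  qed (rule \<open>d j\<close>)
  with above j(1) show ?R by (intro bexI[of _ j]) auto
next
  assume ?R
  then obtain j where j: "j \<in> {1..n}" "\<And>l. 1 \<le> l \<Longrightarrow> l \<le> j \<Longrightarrow> d l"
    "\<And>l. j < l \<Longrightarrow> l \<le> n \<Longrightarrow> \<not> d l"
    by auto
  show ?L
  proof (rule ex1I[of _ j])
    show "j \<in> {1..n} \<and> d j \<noteq> (j < n \<and> d (Suc j))"
      using j(1) j(2)[of j] j(3)[of "Suc j"] by auto
  next
    fix i assume i: "i \<in> {1..n} \<and> d i \<noteq> (i < n \<and> d (Suc i))"
    show "i = j"
    proof (rule linorder_cases)
      assume "i < j"
      then show ?thesis using i j(1) j(2)[of i] j(2)[of "Suc i"] by auto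
    next
      assume "j < i"
      then show ?thesis using i j(3)[of i] j(3)[of "Suc i"] by auto
    qed
  qed
qed

text \<open>The map adding to each bit its next higher bit is linear over the field of two elements.
  Hence adjacency of images depends only on the difference of \<open>u\<close> and \<open>v\<close>,
  and \<open>unique_change_iff_prefix\<close> turns single-bit differences of images into prefix
  differences of arguments.\<close>

lemma prefix_cube_isomorphic_hypercube: "isomorphic (prefix_cube n) (hypercube n)"
proof -
  \<comment> \<open>The guard \<open>i < n\<close> treats the missing bit above \<open>n\<close> as
    False, so the top bit is kept.\<close>
  define f where "f u = (\<lambda>i\<in>{1..n}. u i \<noteq> (i < n \<and> u (Suc i)))" for u :: "nat \<Rightarrow> bool"
  have f_in: "f u \<in> bit_strings n" for u
    by (auto simp: f_def bit_strings_def)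
  have f_diff: "f u i \<noteq> f v i \<longleftrightarrow> (u i \<noteq> v i) \<noteq> (i < n \<and> u (Suc i) \<noteq> v (Suc i))"
    if "i \<in> {1..n}" for u v i
    using that by (auto simp: f_def)
  have "inj_on f (bit_strings n)"
  proof (rule inj_onI)
    fix u v assume uv: "u \<in> bit_strings n" "v \<in> bit_strings n" and eq: "f u = f v"
    \<comment> \<open>Equal images mean that the difference of \<open>u\<close> and \<open>v\<close>
      never changes; with threshold 0 it vanishes at every position.\<close>
    have "\<not> u i \<noteq> v i" if "0 < i" "i \<le> n" for i
      by (rule zero_above_if_no_change[OF _ that, of "\<lambda>i. u i \<noteq> v i"])
        (use f_diff[of _ u v] eq in auto)
    with uv show "u = v" by (intro bit_strings_eqI[of u n v]) auto
  qed
  moreover from this have "f ` bit_strings n = bit_strings n"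
    using f_in by (intro endo_inj_surj finite_bit_strings) auto
  ultimately have "bij_betw f (bit_strings n) (bit_strings n)"
    by (simp add: bij_betw_def)
  moreover have "{u, v} \<in> edges (prefix_cube n) \<longleftrightarrow> {f u, f v} \<in> edges (hypercube n)"
    if "u \<in> bit_strings n" "v \<in> bit_strings n" for u v
  proof -
    have "hypercube_adj n (f u) (f v) \<longleftrightarrow>
        (\<exists>!i. i \<in> {1..n} \<and> (u i \<noteq> v i) \<noteq> (i < n \<and> u (Suc i) \<noteq> v (Suc i)))"
      unfolding hypercube_adj_def by (simp only: f_diff cong: conj_cong)
    also have "\<dots> \<longleftrightarrow> (\<exists>j\<in>{1..n}. augmented_adj n j u v)"
      unfolding unique_change_iff_prefix[of n "\<lambda>i. u i \<noteq> v i"]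
      by (simp only: augmented_adj_def not_not eq_commute[of "v _" "u _"])
    finally show ?thesis
      using that f_in by (simp add: edges_prefix_cube_iff edges_hypercube_iff)
  qed
  ultimately show ?thesis
    by (auto simp: isomorphic_def prefix_cube_def verts_hypercube)
qed

section \<open>Two concrete copies and their common edges\<close>

lemma cube_subgraph_hypercube: "cube_subgraph n (hypercube n)"
proof -
  have "isomorphic (hypercube n) (hypercube n)"
    unfolding isomorphic_def by (rule exI[of _ id]) simp
  moreover have "edges (hypercube n) \<subseteq> edges (augmented_cube n)"
    by (auto simp: hypercube_def augmented_cube_def)
  ultimately show ?thesis
    by (simp add: cube_subgraph_def subgraph_def simple_graph_hypercube verts_hypercube
        verts_augmented_cube)
qed

text \<open>Augmented edges of \<open>augmented_cube n\<close> start at dimension 2, so the prefix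
  flips with \<open>j = 1\<close> have to be found among its hypercube edges.\<close>

lemma augmented_adj_1_hypercube_adj:
  assumes "1 \<le> n" "augmented_adj n 1 u v"
  shows "hypercube_adj n u v"
  unfolding hypercube_adj_def
proof (rule ex1I[of _ 1])
  show "i = 1" if "i \<in> {1..n} \<and> u i \<noteq> v i" for i
  proof (rule ccontr)
    assume "i \<noteq> 1"
    with that have "i \<in> {1<..n}" by auto
    with that assms(2) show False unfolding augmented_adj_def by metis
  qed
qed (use assms in \<open>auto simp: augmented_adj_def\<close>)

lemma cube_subgraph_prefix_cube: "cube_subgraph n (prefix_cube n)"
proof -
  have "edges (prefix_cube n) \<subseteq> edges (augmented_cube n)"
  proof
    fix e assume "e \<in> edges (prefix_cube n)"
    then obtain u v j where e: "e = {u, v}" "u \<in> bit_strings n" "v \<in> bit_strings n"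
      and j: "j \<in> {1..n}" "augmented_adj n j u v"
      by (auto simp: prefix_cube_def)
    have "hypercube_adj n u v \<or> (\<exists>j\<in>{2..n}. augmented_adj n j u v)"
    proof (cases "j = 1")
      case True
      with j show ?thesis using augmented_adj_1_hypercube_adj by auto
    next
      case False
      with j show ?thesis by (intro disjI2 bexI[of _ j]) auto
    qed
    with e show "e \<in> edges (augmented_cube n)"
      by (simp add: edges_augmented_cube_iff)
  qed
  moreover from this have "simple_graph (prefix_cube n)"
    using simple_graph_augmented_cube[of n]
    by (auto simp: simple_graph_def prefix_cube_def verts_augmented_cube)
  ultimately show ?thesis
    using prefix_cube_isomorphic_hypercube
    by (simp add: cube_subgraph_def subgraph_def prefix_cube_def verts_augmented_cube)
qed

text \<open>A prefix flip always changes bit 1 and a hypercube edge changes a single bit, so a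
  common neighbour can only be \<open>u\<close> with bit 1 flipped.\<close>

lemma card_nbrs_hypercube_prefix_cube:
  "card (nbrs (edges (hypercube n) \<inter> edges (prefix_cube n)) u) \<le> 1"
proof -
  let ?N = "nbrs (edges (hypercube n) \<inter> edges (prefix_cube n)) u"
  have diff: "v \<in> bit_strings n \<and> (\<forall>l\<in>{1..n}. (v l \<noteq> u l) = (l = 1))" if "v \<in> ?N" for v
  proof -
    from that obtain j where v: "v \<in> bit_strings n" "hypercube_adj n u v"
      and j: "j \<in> {1..n}" "augmented_adj n j u v"
      by (auto simp: nbrs_def edges_hypercube_iff edges_prefix_cube_iff)
    have uniq: "i = k" if "i \<in> {1..n}" "u i \<noteq> v i" "k \<in> {1..n}" "u k \<noteq> v k" for i k
      using v(2) that unfolding hypercube_adj_def by blast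
    have "u 1 \<noteq> v 1" "u j \<noteq> v j"
      using j by (auto simp: augmented_adj_def)
    then have "l = 1" if "l \<in> {1..n}" "v l \<noteq> u l" for l
      using uniq[of l 1] that by auto
    with \<open>u 1 \<noteq> v 1\<close> v(1) show ?thesis by blast
  qed
  have eq: "v = w" if vw: "v \<in> ?N" "w \<in> ?N" for v w
  proof (rule bit_strings_eqI[of v n w])
    show "v i = w i" if "i \<in> {1..n}" for i
      using that diff[OF vw(1)] diff[OF vw(2)] by blast
  qed (use diff vw in blast)+
  show ?thesis
  proof (cases "?N = {}")
    case False
    then obtain a where "a \<in> ?N" by (metis all_not_in_conv)
    then have "?N \<subseteq> {a}" using eq[of _ a] by (intro subsetI) simp
    then show ?thesis using card_mono[of "{a}" ?N] by simp
  qed simp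
qed

lemma card_hypercube_inter_prefix_cube:
  "2 * card (edges (hypercube n) \<inter> edges (prefix_cube n)) \<le> card (bit_strings n)"
proof -
  let ?M = "edges (hypercube n) \<inter> edges (prefix_cube n)"
  have "2 * card ?M = (\<Sum>v\<in>bit_strings n. card (nbrs ?M v))"
    using cube_subgraph_edges[OF cube_subgraph_hypercube]
    by (intro sum_degrees[symmetric] finite_bit_strings) auto
  also have "\<dots> \<le> (\<Sum>v\<in>bit_strings n. 1)"
    by (intro sum_mono card_nbrs_hypercube_prefix_cube)
  finally show ?thesis by simp
qed

text \<open>Were the two equal, their intersection would have degree \<open>n\<close> at every
  vertex, but its degrees are at most 1. The all-False string serves as a sample vertex.\<close>

lemma hypercube_neq_prefix_cube:
  assumes "2 \<le> n"
  shows "hypercube n \<noteq> prefix_cube n"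
proof
  assume eq: "hypercube n = prefix_cube n"
  have u: "(\<lambda>i\<in>{1..n}. False) \<in> bit_strings n"
    by (simp add: bit_strings_def)
  show False
    using card_nbrs_hypercube_prefix_cube[of n "\<lambda>i\<in>{1..n}. False"] card_nbrs_hypercube[OF u]
      assms by (simp flip: eq)
qed

theorem theorem3p2:
  fixes n :: nat and G1 G2 :: "(nat \<Rightarrow> bool) graph"
  assumes "n \<ge> 2"
    and "cube_subgraph n G1" and "cube_subgraph n G2" and "G1 \<noteq> G2"
    and "\<And>H1 H2. cube_subgraph n H1 \<Longrightarrow> cube_subgraph n H2 \<Longrightarrow> H1 \<noteq> H2 \<Longrightarrow>
           card (edges G1 \<inter> edges G2) \<le> card (edges H1 \<inter> edges H2)"
  shows "perfect_matching (augmented_cube n) (edges G1 \<inter> edges G2)"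
proof (rule perfect_matchingI)
  \<comment> \<open>Minimality is applied to the explicit pair, which is admissible because its
    members are distinct for \<open>n\<close> at least 2.\<close>
  have "card (edges G1 \<inter> edges G2) \<le> card (edges (hypercube n) \<inter> edges (prefix_cube n))"
    using assms(1) by (intro assms(5) cube_subgraph_hypercube cube_subgraph_prefix_cube
        hypercube_neq_prefix_cube)
  with card_hypercube_inter_prefix_cube[of n]
  show "2 * card (edges G1 \<inter> edges G2) \<le> card (verts (augmented_cube n))"
    by (simp add: verts_augmented_cube)
  show "1 \<le> card (nbrs (edges G1 \<inter> edges G2) v)" if "v \<in> verts (augmented_cube n)" for v
    using that assms(1) by (intro cube_subgraphs_common_nbr[OF _ assms(2,3)])
      (simp_all add: verts_augmented_cube)
  show "edges G1 \<inter> edges G2 \<subseteq> edges (augmented_cube n)"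
    "\<forall>e\<in>edges G1 \<inter> edges G2. e \<subseteq> verts (augmented_cube n) \<and> card e = 2"
    using cube_subgraph_edges[OF assms(2)] unfolding verts_augmented_cube by blast+
  show "finite (verts (augmented_cube n))"
    by (simp add: verts_augmented_cube finite_bit_strings)
qed

end
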